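(* Let $\mathcal{S}\subset\mathcal{P}$ be a finite (nonempty) set of parameter values for which we want to estimate the error $\|u(\mu)-\widetilde u(\mu)\|_\Sigma$. Let $0<\delta<1$, $w>\sqrt{e}$ and assume that the integer $K$ satisfies $$K\geq\max\left\{\frac{\log(\#\mathcal{S})+\log(\delta^{-1})}{\log(w/\sqrt{e})},\ 3\right\}.$$ Furthermore, assume that $\Sigma$ is invertible and that $\varepsilon\leq w^{-1}$ (almost surely), where $$\varepsilon=\sup_{\mu\in\mathcal{P}}\left\{\max_{1\leq i\leq K}\|A(\mu)^T\widetilde Y_i(\mu)-Z_i\|_{\Sigma^{-1}}\right\}.$$ Then $$\mathbb{P}\Big\{(w+\varepsilon)^{-1}\widetilde\Delta(\mu)\leq\|u(\mu)-\widetilde u(\mu)\|_\Sigma\leq\frac{w}{1-w\,\varepsilon}\,\widetilde\Delta(\mu),\ \ \forall\mu\in\mathcal{S}\Big\}\geq 1-\delta,$$ where the upper bound is read as vacuous (equal to $+\infty$) if $w\varepsilon=1$.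
   Context: Let $\mathcal{P}\subset\mathbb{R}^P$ be a parameter set. For every $\mu\in\mathcal{P}$, $A(\mu)\in\mathbb{R}^{N\times N}$ is invertible, $f(\mu)\in\mathbb{R}^N$, $u(\mu)\in\mathbb{R}^N$ solves $A(\mu)u(\mu)=f(\mu)$, $\widetilde u(\mu)\in\mathbb{R}^N$ is a given (deterministic) approximation of $u(\mu)$, and $r(\mu)=f(\mu)-A(\mu)\widetilde u(\mu)$ is the residual. $\Sigma\in\mathbb{R}^{N\times N}$ is symmetric positive semi-definite (hence positive definite when invertible), $\|v\|_\Sigma^2=v^T\Sigma v$ and, when $\Sigma$ is invertible, $\|v\|_{\Sigma^{-1}}^2=v^T\Sigma^{-1}v$ for $v\in\mathbb{R}^N$. $Z_1,\ldots,Z_K$ are independent copies of $Z\sim\mathcal{N}(0,\Sigma)$. The random dual problems are $A(\mu)^TY_i(\mu)=Z_i$, $1\leq i\leq K$, with solutions $Y_i(\mu)\in\mathbb{R}^N$. $\widetilde{\mathcal{Y}}\subset\mathbb{R}^N$ is a linear subspace (the dual reduced space), in general a random subspace since it may be built from $Z_1,\ldots,Z_K$. $\widetilde Y_i(\mu)$ is the Galerkin projection of $Y_i(\mu)$ on $\widetilde{\mathcal{Y}}$: $\widetilde Y_i(\mu)\in\widetilde{\mathcal{Y}}$ and $\langle A(\mu)^T\widetilde Y_i(\mu),v\rangle=\langle Z_i,v\rangle$ for all $v\in\widetilde{\mathcal{Y}}$, where $\langle v,w\rangle=v^Tw$; this Galerkin problem is assumed to be uniquely solvable, and the quantities $\widetilde\Delta(\mu)$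 and $\varepsilon$ are assumed to be measurable. The fast-to-evaluate error estimator is $$\widetilde\Delta(\mu)=\left(\frac1K\sum_{i=1}^K\big(\widetilde Y_i(\mu)^Tr(\mu)\big)^2\right)^{1/2}.$$ $\#\mathcal{S}$ denotes the cardinality of $\mathcal{S}$. *)

theory Defs
  imports "HOL-Probability.Probability"
begin

text \<open>The univariate normal law \<open>N(m, s)\<close>, where \<open>s\<close> is the variance; it is the Dirac
  measure at \<open>m\<close> if \<open>s = 0\<close>. (\<open>normal_density\<close> takes the standard deviation.)\<close>

definition normal_law :: "real \<Rightarrow> real \<Rightarrow> real measure" where
  "normal_law m s =
     (if s = 0 then return borel m else density lborel (\<lambda>x. ennreal (normal_density m (sqrt s) x)))"

text \<open>A random vector has law \<open>N(m, \<Sigma>)\<close>, for \<open>\<Sigma>\<close> symmetric positive semi-definite (possibly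
  singular), if every linear functional \<open>v\<^sup>T X\<close> of it has the normal law with mean \<open>v\<^sup>T m\<close>
  and variance \<open>v\<^sup>T \<Sigma> v\<close>.\<close>

definition gaussian_vector ::
  "'w measure \<Rightarrow> ('w \<Rightarrow> real ^ 'n) \<Rightarrow> real ^ 'n \<Rightarrow> real ^ 'n ^ 'n \<Rightarrow> bool" where
  "gaussian_vector M X m \<Sigma> \<longleftrightarrow>
     X \<in> borel_measurable M \<and>
     (\<forall>v. distr M borel (\<lambda>\<omega>. v \<bullet> X \<omega>) = normal_law (v \<bullet> m) (v \<bullet> (\<Sigma> *v v)))"

definition weighted_norm :: "real ^ 'n ^ 'n \<Rightarrow> real ^ 'n \<Rightarrow> real" where
  "weighted_norm \<Sigma> v = sqrt (v \<bullet> (\<Sigma> *v v))"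

definition residual ::
  "('p \<Rightarrow> real ^ 'n ^ 'n) \<Rightarrow> ('p \<Rightarrow> real ^ 'n) \<Rightarrow> ('p \<Rightarrow> real ^ 'n) \<Rightarrow> 'p \<Rightarrow> real ^ 'n" where
  "residual A f ut \<mu> = f \<mu> - A \<mu> *v ut \<mu>"

definition galerkin_solution ::
  "real ^ 'n ^ 'n \<Rightarrow> (real ^ 'n) set \<Rightarrow> real ^ 'n \<Rightarrow> real ^ 'n \<Rightarrow> bool" where
  "galerkin_solution B V z y \<longleftrightarrow> y \<in> V \<and> (\<forall>v\<in>V. (B *v y) \<bullet> v = z \<bullet> v)"

definition error_estimator ::
  "nat \<Rightarrow> (nat \<Rightarrow> 'p \<Rightarrow> 'w \<Rightarrow> real ^ 'n) \<Rightarrow> ('p \<Rightarrow> real ^ 'n) \<Rightarrow> 'p \<Rightarrow> 'w \<Rightarrow> real" where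
  "error_estimator K Yt r \<mu> \<omega> = sqrt (1 / real K * (\<Sum>i=1..K. (Yt i \<mu> \<omega> \<bullet> r \<mu>)\<^sup>2))"

text \<open>The supremum over the (possibly infinite) parameter set is taken in the extended reals, so
  that an upper bound on it does bound every term.\<close>

definition dual_residual_sup ::
  "'p set \<Rightarrow> nat \<Rightarrow> ('p \<Rightarrow> real ^ 'n ^ 'n) \<Rightarrow> real ^ 'n ^ 'n \<Rightarrow>
   (nat \<Rightarrow> 'w \<Rightarrow> real ^ 'n) \<Rightarrow> (nat \<Rightarrow> 'p \<Rightarrow> 'w \<Rightarrow> real ^ 'n) \<Rightarrow> 'w \<Rightarrow> ereal" where
  "dual_residual_sup P K A \<Sigma> Z Yt \<omega> =
     (SUP \<mu>\<in>P. ereal (MAX i\<in>{1..K}.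
        weighted_norm (matrix_inv \<Sigma>) (transpose (A \<mu>) *v Yt i \<mu> \<omega> - Z i \<omega>)))"

text \<open>The bound \<open>w / (1 - w \<epsilon>) * d\<close>, read as \<open>\<infinity>\<close> if \<open>w \<epsilon> = 1\<close>. The explicit case
  distinction is needed: division by zero would give \<open>0\<close> in the reals, and
  \<open>\<infinity> * 0 = 0\<close> in the extended reals.\<close>

definition upper_bound :: "real \<Rightarrow> real \<Rightarrow> real \<Rightarrow> ereal" where
  "upper_bound w \<epsilon> d = (if w * \<epsilon> = 1 then \<infinity> else ereal (w / (1 - w * \<epsilon>) * d))"

end

theory Submission
  imports Defs
begin

text \<open>
  Write \<open>e = u - ut\<close> for the error, so that the residual is \<open>r = A e\<close>. If the dual problems were
  solved exactly, the estimator would be the root mean square \<open>D\<close> of the numbers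
  \<open>Y\<^sub>i \<bullet> r = (A\<^sup>T Y\<^sub>i) \<bullet> e = Z\<^sub>i \<bullet> e\<close>. These are independent centred normal variables whose
  variance \<open>e \<bullet> \<Sigma> e\<close> is the square of the norm to be estimated. Hence, for \<open>e \<noteq> 0\<close>, \<open>K D\<^sup>2\<close>
  divided by that variance is chi-square distributed with \<open>K\<close> degrees of freedom, and \<open>D\<close> is
  within the factor \<open>w\<close> of the norm of \<open>e\<close> with high probability.

  The moment generating function of a squared normal variable is explicit
  (\<open>nn_integral_exp_square_normal_law\<close>), so both tails have a Chernoff bound
  (\<open>normal_sum_squares_tail\<close>). Their sum is at most \<open>(sqrt (exp 1) / w) ^ K\<close> once \<open>K \<ge> 3\<close> and
  \<open>w > sqrt (exp 1)\<close> (\<open>two_chernoff_bounds\<close>). The hypothesis on \<open>K\<close> says that \<open>card S\<close> times this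
  number is at most \<open>\<delta>\<close>, so a union bound makes the comparison of \<open>D\<close> with the norm valid
  simultaneously for all of \<open>S\<close>.

  The rest is deterministic. Replacing \<open>Z\<^sub>i\<close> by \<open>A\<^sup>T Yt\<^sub>i\<close> changes the \<open>i\<close>-th number by the inner
  product of the dual residual with \<open>e\<close>; by the Cauchy-Schwarz inequality between the norms of
  \<open>\<Sigma>\<close> and its inverse (\<open>abs_inner_le_weighted_norm\<close>) this is at most \<open>\<epsilon>\<close> times the norm of \<open>e\<close>.
  Minkowski's inequality carries the same bound over to the root mean square
  (\<open>L2_set_uniformly_close\<close>), and combining the two comparisons gives the two inequalities
  (\<open>effectivity_bounds\<close>). All this happens outcome by outcome, so a dual reduced space that is
  itself built from the \<open>Z\<^sub>i\<close> causes no difficulty.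
\<close>

section \<open>Weighted norms\<close>

lemma matrix_mult_inv_vec:
  fixes \<Sigma> :: "real ^ 'n ^ 'n"
  assumes "invertible \<Sigma>"
  shows "\<Sigma> *v (matrix_inv \<Sigma> *v x) = x"
proof -
  have "\<exists>B. \<Sigma> ** B = mat 1 \<and> B ** \<Sigma> = mat 1"
    using assms by (simp add: invertible_def)
  then have "\<Sigma> ** matrix_inv \<Sigma> = mat 1"
    unfolding matrix_inv_def by (metis (mono_tags, lifting) someI_ex)
  then show ?thesis
    by (simp add: matrix_vector_mul_assoc)
qed

lemma symmetric_form_commute:
  fixes \<Sigma> :: "real ^ 'n ^ 'n"
  assumes "transpose \<Sigma> = \<Sigma>"
  shows "x \<bullet> (\<Sigma> *v y) = y \<bullet> (\<Sigma> *v x)"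
  using assms by (metis dot_lmul_matrix inner_commute vector_transpose_matrix)

text \<open>The discriminant argument, for a form that is only semi-definite: where the form vanishes at
  \<open>y\<close>, the expansion at \<open>x + t y\<close> is affine in \<open>t\<close> and bounded below, hence constant.\<close>

lemma psd_Cauchy_Schwarz:
  fixes \<Sigma> :: "real ^ 'n ^ 'n"
  assumes sym: "transpose \<Sigma> = \<Sigma>" and psd: "\<And>v. 0 \<le> v \<bullet> (\<Sigma> *v v)"
  shows "(x \<bullet> (\<Sigma> *v y))\<^sup>2 \<le> (x \<bullet> (\<Sigma> *v x)) * (y \<bullet> (\<Sigma> *v y))"
proof -
  have expand: "0 \<le> x \<bullet> (\<Sigma> *v x) + 2 * t * (x \<bullet> (\<Sigma> *v y)) + t\<^sup>2 * (y \<bullet> (\<Sigma> *v y))" for t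
    using psd[of "x + t *\<^sub>R y"] symmetric_form_commute[OF sym, of y x]
    by (simp add: matrix_vector_right_distrib matrix_vector_mult_scaleR inner_add_left
        inner_add_right power2_eq_square algebra_simps)
  show ?thesis
  proof (cases "y \<bullet> (\<Sigma> *v y) = 0")
    case True
    have "x \<bullet> (\<Sigma> *v y) = 0"
    proof (rule ccontr)
      assume b: "x \<bullet> (\<Sigma> *v y) \<noteq> 0"
      show False
        using expand[of "- (x \<bullet> (\<Sigma> *v x) + 1) / (2 * (x \<bullet> (\<Sigma> *v y)))"] b True by (simp add: field_simps)
    qed
    then show ?thesis using True by simp
  next
    case False
    then have pos: "0 < y \<bullet> (\<Sigma> *v y)" using psd[of y] by simp
    show ?thesis
      using expand[of "- (x \<bullet> (\<Sigma> *v y)) / (y \<bullet> (\<Sigma> *v y))"] pos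
      by (simp add: field_simps power2_eq_square)
  qed
qed

text \<open>The norms of \<open>\<Sigma>\<close> and its inverse are dual: with \<open>x = \<Sigma> x'\<close>, the left-hand side is the
  \<open>\<Sigma>\<close>-inner product of \<open>x'\<close> and \<open>y\<close>, and the \<open>\<Sigma>\<close>-norm of \<open>x'\<close> is the dual norm of \<open>x\<close>.\<close>

lemma abs_inner_le_weighted_norm:
  fixes \<Sigma> :: "real ^ 'n ^ 'n"
  assumes sym: "transpose \<Sigma> = \<Sigma>" and psd: "\<And>v. 0 \<le> v \<bullet> (\<Sigma> *v v)" and inv: "invertible \<Sigma>"
  shows "\<bar>x \<bullet> y\<bar> \<le> weighted_norm (matrix_inv \<Sigma>) x * weighted_norm \<Sigma> y"
proof -
  define x' where "x' = matrix_inv \<Sigma> *v x"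
  have x: "\<Sigma> *v x' = x"
    by (simp add: x'_def matrix_mult_inv_vec[OF inv])
  have "(x \<bullet> y)\<^sup>2 \<le> (x \<bullet> x') * (y \<bullet> (\<Sigma> *v y))"
    using psd_Cauchy_Schwarz[OF sym psd, of y x'] unfolding x
    by (simp add: inner_commute mult.commute)
  then have "sqrt ((x \<bullet> y)\<^sup>2) \<le> sqrt ((x \<bullet> x') * (y \<bullet> (\<Sigma> *v y)))"
    by (rule real_sqrt_le_mono)
  then show ?thesis
    by (simp add: weighted_norm_def x'_def real_sqrt_mult)
qed

lemma dual_norm_nonneg:
  fixes \<Sigma> :: "real ^ 'n ^ 'n"
  assumes psd: "\<And>v. 0 \<le> v \<bullet> (\<Sigma> *v v)" and inv: "invertible \<Sigma>"
  shows "0 \<le> weighted_norm (matrix_inv \<Sigma>) x"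
  using psd[of "matrix_inv \<Sigma> *v x"]
  by (simp add: weighted_norm_def matrix_mult_inv_vec[OF inv] inner_commute)

lemma positive_definite:
  fixes \<Sigma> :: "real ^ 'n ^ 'n"
  assumes sym: "transpose \<Sigma> = \<Sigma>" and psd: "\<And>v. 0 \<le> v \<bullet> (\<Sigma> *v v)" and inv: "invertible \<Sigma>"
    and "e \<noteq> 0"
  shows "0 < e \<bullet> (\<Sigma> *v e)"
proof (rule ccontr)
  assume "\<not> 0 < e \<bullet> (\<Sigma> *v e)"
  with psd[of e] have "weighted_norm \<Sigma> e = 0"
    by (simp add: weighted_norm_def)
  with abs_inner_le_weighted_norm[OF sym psd inv, of e e] have "e \<bullet> e \<le> 0" by simp
  then have "e = 0" using inner_ge_zero[of e] inner_eq_zero_iff[of e] by linarith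
  with \<open>e \<noteq> 0\<close> show False by simp
qed

section \<open>Concentration of sums of squares of normal variables\<close>

text \<open>The moment generating function of a squared normal variable, parametrised by its value \<open>a\<close>
  instead of the exponent: the exponent is chosen so that tilting the density by it multiplies
  the standard deviation by \<open>a\<close> and the total mass by \<open>a\<close>.\<close>

lemma nn_integral_exp_square_normal_law:
  assumes s: "0 < s" and a: "0 < a"
  shows "(\<integral>\<^sup>+ x. ennreal (exp ((a\<^sup>2 - 1) / (2 * s * a\<^sup>2) * x\<^sup>2)) \<partial>normal_law 0 s) = ennreal a"
proof -
  have eq: "normal_density 0 (sqrt s) x * exp ((a\<^sup>2 - 1) / (2 * s * a\<^sup>2) * x\<^sup>2)
      = a * normal_density 0 (a * sqrt s) x" for x
  proof -
    have "exp (- x\<^sup>2 / (2 * s)) * exp ((a\<^sup>2 - 1) / (2 * s * a\<^sup>2) * x\<^sup>2) = exp (- x\<^sup>2 / (2 * (a\<^sup>2 * s)))"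
      unfolding exp_add[symmetric] using s a by (simp add: field_simps)
    moreover have "1 / sqrt (2 * pi * s) = a * (1 / sqrt (2 * pi * (a\<^sup>2 * s)))"
      using s a by (simp add: real_sqrt_mult)
    ultimately show ?thesis
      using s a by (simp add: normal_density_def power_mult_distrib)
  qed
  have "(\<integral>\<^sup>+ x. ennreal (exp ((a\<^sup>2 - 1) / (2 * s * a\<^sup>2) * x\<^sup>2)) \<partial>normal_law 0 s)
      = (\<integral>\<^sup>+ x. ennreal (normal_density 0 (sqrt s) x) * ennreal (exp ((a\<^sup>2 - 1) / (2 * s * a\<^sup>2) * x\<^sup>2)) \<partial>lborel)"
    using s by (simp add: normal_law_def nn_integral_density)
  also have "\<dots> = (\<integral>\<^sup>+ x. ennreal a * ennreal (normal_density 0 (a * sqrt s) x) \<partial>lborel)"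
    using a by (simp only: ennreal_mult'[symmetric] eq normal_density_nonneg less_imp_le)
  also have "\<dots> = ennreal a * (\<integral>\<^sup>+ x. ennreal (normal_density 0 (a * sqrt s) x) \<partial>lborel)"
    by (rule nn_integral_cmult) simp
  also have "(\<integral>\<^sup>+ x. ennreal (normal_density 0 (a * sqrt s) x) \<partial>lborel) = 1"
    using s a by (subst nn_integral_eq_integral) auto
  finally show ?thesis by simp
qed

text \<open>Chernoff's bound with the exponent for which the tilted expected sum of squares equals the
  threshold. The factor \<open>a\<^sup>2 - 1\<close> on both sides of the event gives the upper tail for \<open>a > 1\<close> and
  the lower tail for \<open>a < 1\<close>.\<close>

lemma (in prob_space) normal_sum_squares_tail:
  fixes X :: "'i \<Rightarrow> 'a \<Rightarrow> real" and s a :: real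
  assumes fin: "finite I" and ind: "indep_vars (\<lambda>_. borel) X I"
    and law: "\<And>i. i \<in> I \<Longrightarrow> distr M borel (X i) = normal_law 0 s"
    and s: "0 < s" and a: "0 < a"
  shows "prob {\<omega> \<in> space M. (a\<^sup>2 - 1) * (\<Sum>i\<in>I. (X i \<omega>)\<^sup>2) \<ge> (a\<^sup>2 - 1) * (card I * (s * a\<^sup>2))}
           \<le> (a * exp ((1 - a\<^sup>2) / 2)) ^ card I"
proof -
  define c where "c = (a\<^sup>2 - 1) / (2 * s * a\<^sup>2)"
  have [measurable]: "i \<in> I \<Longrightarrow> X i \<in> borel_measurable M" for i
    using ind by (simp add: indep_vars_def)
  have exponent: "c * (card I * (s * a\<^sup>2)) = card I * ((a\<^sup>2 - 1) / 2)"
    using s a by (simp add: c_def field_simps)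
  have scale: "(a\<^sup>2 - 1) * y \<le> (a\<^sup>2 - 1) * z \<longleftrightarrow> c * y \<le> c * z" for y z
  proof -
    have p: "0 < 2 * s * a\<^sup>2" using s a by simp
    have "(a\<^sup>2 - 1) * v = 2 * s * a\<^sup>2 * (c * v)" for v
      using s a by (simp add: c_def)
    then show ?thesis by (simp only: mult_le_cancel_left_pos[OF p])
  qed
  have "{\<omega> \<in> space M. (a\<^sup>2 - 1) * (\<Sum>i\<in>I. (X i \<omega>)\<^sup>2) \<ge> (a\<^sup>2 - 1) * (card I * (s * a\<^sup>2))}
      = {\<omega> \<in> space M. card I * ((a\<^sup>2 - 1) / 2) \<le> c * (\<Sum>i\<in>I. (X i \<omega>)\<^sup>2)}"
    by (simp only: scale exponent)
  then have "ennreal (prob {\<omega> \<in> space M. (a\<^sup>2 - 1) * (\<Sum>i\<in>I. (X i \<omega>)\<^sup>2) \<ge> (a\<^sup>2 - 1) * (card I * (s * a\<^sup>2))})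
      = emeasure M {\<omega> \<in> space M. card I * ((a\<^sup>2 - 1) / 2) \<le> c * (\<Sum>i\<in>I. (X i \<omega>)\<^sup>2)}"
    by (simp add: emeasure_eq_measure)
  also have "\<dots> \<le> ennreal (exp (- 1 * (card I * ((a\<^sup>2 - 1) / 2)))) *
      (\<integral>\<^sup>+ \<omega> \<in> space M. exp (1 * (c * (\<Sum>i\<in>I. (X i \<omega>)\<^sup>2))) \<partial>M)"
    by (intro Chernoff_ineq_nn_integral_ge) auto
  also have "(\<integral>\<^sup>+ \<omega> \<in> space M. exp (1 * (c * (\<Sum>i\<in>I. (X i \<omega>)\<^sup>2))) \<partial>M)
      = (\<integral>\<^sup>+ \<omega>. (\<Prod>i\<in>I. ennreal (exp (c * (X i \<omega>)\<^sup>2))) \<partial>M)"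
    by (intro nn_integral_cong) (simp_all add: sum_distrib_left exp_sum fin prod_ennreal)
  also have "\<dots> = (\<Prod>i\<in>I. \<integral>\<^sup>+ \<omega>. ennreal (exp (c * (X i \<omega>)\<^sup>2)) \<partial>M)"
    by (intro indep_vars_nn_integral fin indep_vars_compose2[OF ind]) auto
  also have "\<dots> = (\<Prod>i\<in>I. ennreal a)"
  proof (rule prod.cong[OF refl])
    fix i assume i: "i \<in> I"
    have "(\<integral>\<^sup>+ \<omega>. ennreal (exp (c * (X i \<omega>)\<^sup>2)) \<partial>M) = (\<integral>\<^sup>+ x. ennreal (exp (c * x\<^sup>2)) \<partial>distr M borel (X i))"
      using i by (subst nn_integral_distr) auto
    then show "(\<integral>\<^sup>+ \<omega>. ennreal (exp (c * (X i \<omega>)\<^sup>2)) \<partial>M) = ennreal a"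
      using nn_integral_exp_square_normal_law[OF s a] by (simp add: law[OF i] c_def)
  qed
  also have "ennreal (exp (- 1 * (card I * ((a\<^sup>2 - 1) / 2)))) * \<dots> = ennreal ((a * exp ((1 - a\<^sup>2) / 2)) ^ card I)"
  proof -
    have "exp (- 1 * (card I * ((a\<^sup>2 - 1) / 2))) = exp ((1 - a\<^sup>2) / 2) ^ card I"
      by (simp add: exp_of_nat_mult[symmetric] algebra_simps diff_divide_distrib)
    then show ?thesis
      using a by (simp add: power_mult_distrib ennreal_mult'[symmetric] ennreal_power mult.commute)
  qed
  finally show ?thesis
    using a by (subst (asm) ennreal_le_iff) auto
qed

text \<open>With \<open>x = w\<^sup>2\<close>, the summands are the Chernoff bounds of the lower and the upper tail, each
  divided by \<open>(sqrt (exp 1) / w) ^ n\<close>. Both decrease in \<open>n\<close>, so only \<open>n = 3\<close> matters. There the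
  first summand is at most \<open>1 - (3/2) / (x + 3/2)\<close>, and the second has to fit into the remainder.
  This leaves little room at \<open>x = exp 1\<close>, where the second summand is about \<open>0.340\<close> and the
  remainder about \<open>0.356\<close>, whence the decimal bounds on \<open>exp 1\<close> in the proof.\<close>

lemma exp_tail_sum_le_one:
  fixes x :: real
  assumes x: "exp 1 \<le> x" and n: "3 \<le> n"
  shows "exp (- 1 / (2 * x)) ^ n + (x * exp (- x / 2)) ^ n \<le> 1"
proof -
  define E :: real where "E = exp 1"
  have E: "2718 / 1000 < E" "E < 272 / 100"
  proof -
    have "\<bar>E - 5837465777 / 2147483648\<bar> \<le> 1 / 4294967296"
      using e_approx_32 by (simp add: E_def)
    then show "2718 / 1000 < E" "E < 272 / 100" by linarith+
  qed
  have x0: "0 < x" "E \<le> x" "2718 / 1000 < x" using x E by (auto simp: E_def)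
  \<comment> \<open>The tangent bound for \<open>ln\<close> at \<open>E\<close>, in exponential form; it is an equality at \<open>x = E\<close>, where
    the estimate is nearly tight.\<close>
  have xE: "x \<le> exp (x / E)"
  proof -
    have "x / E \<le> exp (x / E - 1)"
      using exp_ge_add_one_self[of "x / E - 1"] by simp
    also have "\<dots> = exp (x / E) / E"
      by (simp add: exp_diff E_def)
    finally show ?thesis
      using E by (simp add: divide_le_cancel)
  qed
  have "x * exp (- x / 2) \<le> 1"
  proof -
    have "x \<le> exp (x / 2)"
    proof -
      have "x / E \<le> x / 2" using E x0 by (intro divide_left_mono) auto
      then show ?thesis using xE by (meson exp_le_cancel_iff order_trans)
    qed
    then show ?thesis by (simp add: exp_minus field_simps)
  qed
  then have "(x * exp (- x / 2)) ^ n \<le> (x * exp (- x / 2)) ^ 3"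
    using n x0 by (intro power_decreasing) auto
  moreover have "exp (- 1 / (2 * x)) ^ n \<le> exp (- 1 / (2 * x)) ^ 3"
    using n x0 by (intro power_decreasing) auto
  moreover have "exp (- 1 / (2 * x)) ^ 3 \<le> x / (x + 3 / 2)"
  proof -
    have "1 + 3 / (2 * x) \<le> exp (3 / (2 * x))" by (rule exp_ge_add_one_self)
    moreover have "exp (- 1 / (2 * x)) ^ 3 = inverse (exp (3 / (2 * x)))"
      by (simp add: exp_of_nat_mult[symmetric] exp_minus[symmetric])
    ultimately have "exp (- 1 / (2 * x)) ^ 3 \<le> inverse (1 + 3 / (2 * x))"
      using x0 by (simp add: le_imp_inverse_le add_pos_pos)
    also have "\<dots> = x / (x + 3 / 2)" using x0 by (simp add: field_simps)
    finally show ?thesis .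
  qed
  moreover have "(x * exp (- x / 2)) ^ 3 \<le> (3 / 2) / (x + 3 / 2)"
  proof -
    \<comment> \<open>After \<open>x \<le> exp (x / E)\<close> the claim reads \<open>x + 3/2 \<le> 3/2 * exp (g * x)\<close>. The logarithm
      of the left side is concave and that of the right side affine, so it suffices to compare
      values and logarithmic slopes at \<open>x = E\<close>.\<close>
    define g where "g = 3 / 2 - 3 / E"
    have g: "1 / (E + 3 / 2) \<le> g"
    proof -
      have "3 / E \<le> 3 / (2718 / 1000)" "1 / (E + 3 / 2) \<le> 1 / (4218 / 1000)"
        using E by (auto simp: pos_divide_le_eq)
      then show ?thesis by (simp add: g_def)
    qed
    have "(x + 3 / 2) = (E + 3 / 2) * (1 + (x - E) / (E + 3 / 2))"
      using E by (simp add: field_simps)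
    also have "\<dots> \<le> (E + 3 / 2) * exp (g * (x - E))"
    proof (rule mult_left_mono)
      have "1 + (x - E) / (E + 3 / 2) \<le> 1 + g * (x - E)"
        using mult_right_mono[OF g, of "x - E"] x0 by simp
      also have "\<dots> \<le> exp (g * (x - E))" by (rule exp_ge_add_one_self)
      finally show "1 + (x - E) / (E + 3 / 2) \<le> exp (g * (x - E))" .
    qed (use E in simp)
    also have "\<dots> \<le> (3 / 2 * exp (g * E)) * exp (g * (x - E))"
    proof (rule mult_right_mono)
      have "g * E = 1 + (3 / 2 * E - 4)" using E by (simp add: g_def field_simps)
      then have "exp (g * E) = E * exp (3 / 2 * E - 4)" by (simp only: exp_add E_def)
      moreover have "3 / 2 * E - 3 \<le> exp (3 / 2 * E - 4)"
        using exp_ge_add_one_self[of "3 / 2 * E - 4"] by simp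
      ultimately have "E * (3 / 2 * E - 3) \<le> exp (g * E)" using E by simp
      moreover have "2718 / 1000 * (1077 / 1000) \<le> E * (3 / 2 * E - 3)"
        using E by (intro mult_mono) auto
      ultimately show "E + 3 / 2 \<le> 3 / 2 * exp (g * E)" using E by simp
    qed simp
    also have "\<dots> = 3 / 2 * exp (g * x)"
      by (simp add: exp_add[symmetric] algebra_simps)
    finally have lin: "x + 3 / 2 \<le> 3 / 2 * exp (g * x)" .
    have "(x * exp (- x / 2)) ^ 3 \<le> (exp (x / E) * exp (- x / 2)) ^ 3"
      using xE x0 by (intro power_mono mult_right_mono) auto
    also have "\<dots> = inverse (exp (g * x))"
      by (simp add: exp_add[symmetric] exp_of_nat_mult[symmetric] exp_minus[symmetric] g_def algebra_simps)
    also have "\<dots> \<le> (3 / 2) / (x + 3 / 2)"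
      using lin x0 by (simp add: field_simps)
    finally show ?thesis .
  qed
  moreover have "x / (x + 3 / 2) + (3 / 2) / (x + 3 / 2) = 1"
    unfolding add_divide_distrib[symmetric] using x0 by simp
  ultimately show ?thesis by linarith
qed

text \<open>The two summands are not alike: the bound for the lower tail alone approaches the
  right-hand side as \<open>w\<close> grows, and the bound for the upper tail has to fit into the remaining factor
  \<open>1 - exp (- n / (2 w\<^sup>2))\<close>.\<close>

lemma two_chernoff_bounds:
  fixes w :: real
  assumes w: "sqrt (exp 1) < w" and n: "3 \<le> n"
  shows "(w * exp ((1 - w\<^sup>2) / 2)) ^ n + (1 / w * exp ((1 - (1 / w)\<^sup>2) / 2)) ^ n \<le> (sqrt (exp 1) / w) ^ n"
proof -
  have w0: "0 < w" using w by (meson exp_ge_zero le_less_trans real_sqrt_ge_zero)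
  have root: "sqrt (exp 1) = exp (1 / 2 :: real)"
    by (rule real_sqrt_unique) (simp_all add: exp_of_nat_mult[symmetric])
  have x: "exp 1 \<le> w\<^sup>2"
    using power_mono[OF less_imp_le[OF w], of 2] by simp
  have "w * exp ((1 - w\<^sup>2) / 2) = sqrt (exp 1) / w * (w\<^sup>2 * exp (- w\<^sup>2 / 2))"
  proof -
    have "exp ((1 - w\<^sup>2) / 2) = exp (1 / 2) * exp (- w\<^sup>2 / 2)"
      by (simp add: exp_add[symmetric] diff_divide_distrib)
    then show ?thesis using w0 by (simp add: root power2_eq_square)
  qed
  moreover have "1 / w * exp ((1 - (1 / w)\<^sup>2) / 2) = sqrt (exp 1) / w * exp (- 1 / (2 * w\<^sup>2))"
  proof -
    have "exp ((1 - (1 / w)\<^sup>2) / 2) = exp (1 / 2) * exp (- 1 / (2 * w\<^sup>2))"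
      by (simp add: exp_add[symmetric] diff_divide_distrib power_divide)
    then show ?thesis by (simp add: root)
  qed
  ultimately have "(w * exp ((1 - w\<^sup>2) / 2)) ^ n + (1 / w * exp ((1 - (1 / w)\<^sup>2) / 2)) ^ n
      = (sqrt (exp 1) / w) ^ n * (exp (- 1 / (2 * w\<^sup>2)) ^ n + (w\<^sup>2 * exp (- w\<^sup>2 / 2)) ^ n)"
    by (simp only: power_mult_distrib distrib_left add.commute)
  also have "\<dots> \<le> (sqrt (exp 1) / w) ^ n * 1"
    using exp_tail_sum_le_one[OF x n] w0 by (intro mult_left_mono) auto
  finally show ?thesis by simp
qed

lemma (in prob_space) normal_sum_squares_concentration:
  fixes X :: "'i \<Rightarrow> 'a \<Rightarrow> real" and s w :: real
  assumes fin: "finite I" and ind: "indep_vars (\<lambda>_. borel) X I"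
    and law: "\<And>i. i \<in> I \<Longrightarrow> distr M borel (X i) = normal_law 0 s"
    and s: "0 < s" and w: "sqrt (exp 1) < w" and n: "3 \<le> card I"
  shows "prob {\<omega> \<in> space M. \<not> (card I * (s / w\<^sup>2) \<le> (\<Sum>i\<in>I. (X i \<omega>)\<^sup>2) \<and>
                              (\<Sum>i\<in>I. (X i \<omega>)\<^sup>2) \<le> card I * (s * w\<^sup>2))}
           \<le> (sqrt (exp 1) / w) ^ card I"
proof -
  have w1: "1 < w"
    by (rule less_trans[OF _ w]) simp
  have [measurable]: "i \<in> I \<Longrightarrow> X i \<in> borel_measurable M" for i
    using ind by (simp add: indep_vars_def)
  define T where "T a = {\<omega> \<in> space M. (a\<^sup>2 - 1) * (\<Sum>i\<in>I. (X i \<omega>)\<^sup>2) \<ge> (a\<^sup>2 - 1) * (card I * (s * a\<^sup>2))}" for a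
  have T [measurable]: "T a \<in> events" for a
    unfolding T_def by measurable
  have "1 < w\<^sup>2" using w1 by (simp add: power2_eq_square less_1_mult)
  then have signs: "0 < w\<^sup>2 - 1" "(1 / w)\<^sup>2 - 1 < 0"
    by (simp_all add: power_divide divide_less_eq)
  have "{\<omega> \<in> space M. \<not> (card I * (s / w\<^sup>2) \<le> (\<Sum>i\<in>I. (X i \<omega>)\<^sup>2) \<and>
                              (\<Sum>i\<in>I. (X i \<omega>)\<^sup>2) \<le> card I * (s * w\<^sup>2))} \<subseteq> T w \<union> T (1 / w)"
  proof safe
    fix \<omega> assume \<omega>: "\<omega> \<in> space M" "\<omega> \<notin> T (1 / w)"
    show "card I * (s / w\<^sup>2) \<le> (\<Sum>i\<in>I. (X i \<omega>)\<^sup>2)"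
    proof (rule ccontr)
      assume "\<not> card I * (s / w\<^sup>2) \<le> (\<Sum>i\<in>I. (X i \<omega>)\<^sup>2)"
      then have "(\<Sum>i\<in>I. (X i \<omega>)\<^sup>2) \<le> card I * (s * (1 / w)\<^sup>2)"
        by (simp add: power_divide)
      then have "\<omega> \<in> T (1 / w)"
        using signs(2) \<omega>(1) unfolding T_def by (simp only: mem_Collect_eq mult_left_mono_neg less_imp_le simp_thms)
      with \<omega>(2) show False by simp
    qed
  next
    fix \<omega> assume \<omega>: "\<omega> \<in> space M" "\<omega> \<notin> T w"
    then show "(\<Sum>i\<in>I. (X i \<omega>)\<^sup>2) \<le> card I * (s * w\<^sup>2)"
      using signs(1) mult_left_mono[of "card I * (s * w\<^sup>2)" "\<Sum>i\<in>I. (X i \<omega>)\<^sup>2" "w\<^sup>2 - 1"]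
      unfolding T_def by force
  qed
  then have "prob {\<omega> \<in> space M. \<not> (card I * (s / w\<^sup>2) \<le> (\<Sum>i\<in>I. (X i \<omega>)\<^sup>2) \<and>
                              (\<Sum>i\<in>I. (X i \<omega>)\<^sup>2) \<le> card I * (s * w\<^sup>2))} \<le> prob (T w \<union> T (1 / w))"
    by (intro finite_measure_mono) auto
  also have "\<dots> \<le> prob (T w) + prob (T (1 / w))"
    by (rule measure_Un_le) auto
  also have "\<dots> \<le> (w * exp ((1 - w\<^sup>2) / 2)) ^ card I + (1 / w * exp ((1 - (1 / w)\<^sup>2) / 2)) ^ card I"
    unfolding T_def using w1 by (intro add_mono normal_sum_squares_tail[OF fin ind law s]) auto
  also have "\<dots> \<le> (sqrt (exp 1) / w) ^ card I"
    by (rule two_chernoff_bounds[OF w n])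
  finally show ?thesis .
qed

text \<open>The lower bound on \<open>K\<close> is the logarithm of the conclusion, solved for \<open>K\<close>.\<close>

lemma union_bound_budget:
  fixes w \<delta> :: real
  assumes w: "sqrt (exp 1) < w" and \<delta>: "0 < \<delta>" and m: "0 < m"
    and K: "real K \<ge> (ln (real m) + ln (inverse \<delta>)) / ln (w / sqrt (exp 1))"
  shows "real m * (sqrt (exp 1) / w) ^ K \<le> \<delta>"
proof -
  define b where "b = w / sqrt (exp 1)"
  have b: "1 < b" using w by (simp add: b_def)
  have "ln (real m * inverse \<delta>) = ln (real m) + ln (inverse \<delta>)"
    using m \<delta> by (simp add: ln_mult_pos del: ln_inverse)
  also have "\<dots> \<le> real K * ln b"
    using K b m \<delta> by (simp add: b_def[symmetric] pos_divide_le_eq)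
  also have "\<dots> = ln (b ^ K)"
    using b by (simp add: ln_realpow)
  finally have "real m * inverse \<delta> \<le> b ^ K"
    using b m \<delta> by simp
  moreover have "(sqrt (exp 1) / w) ^ K = inverse (b ^ K)"
    by (simp add: b_def power_divide)
  ultimately show ?thesis
    using b \<delta> by (simp add: field_simps)
qed

section \<open>From exact to approximate dual solutions\<close>

lemma L2_set_uniformly_close:
  assumes "finite I" and "\<And>i. i \<in> I \<Longrightarrow> \<bar>x i - y i\<bar> \<le> c"
  shows "\<bar>L2_set x I - L2_set y I\<bar> \<le> sqrt (card I) * c"
proof (cases "I = {}")
  case False
  then have c: "0 \<le> c" using assms(2) by fastforce
  have "L2_set x I \<le> L2_set y I + sqrt (card I) * c"
    if "\<And>i. i \<in> I \<Longrightarrow> \<bar>x i - y i\<bar> \<le> c" for x y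
  proof -
    have "L2_set x I \<le> L2_set y I + L2_set (\<lambda>i. \<bar>x i - y i\<bar>) I"
      using L2_set_triangle_ineq[of y "\<lambda>i. x i - y i" I] by (simp add: L2_set_def)
    also have "L2_set (\<lambda>i. \<bar>x i - y i\<bar>) I \<le> L2_set (\<lambda>_. c) I"
      using that by (intro L2_set_mono) auto
    finally show ?thesis using c by (simp add: L2_set_constant)
  qed
  from this[of x y] this[of y x] show ?thesis
    using assms(2) by (fastforce simp: abs_le_iff abs_minus_commute)
qed simp

text \<open>Here \<open>N\<close> is the norm of the error, \<open>D\<close> the estimator with exact dual solutions and \<open>D'\<close> the
  computable one. The upper bound absorbs the term \<open>w * \<epsilon> * N\<close> into the left-hand side, which is
  why it degenerates at \<open>w * \<epsilon> = 1\<close>.\<close>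

lemma effectivity_bounds:
  assumes w: "0 < w" and \<epsilon>: "0 \<le> \<epsilon>" "w * \<epsilon> \<le> 1"
    and conc: "N / w \<le> D" "D \<le> w * N" and close: "\<bar>D' - D\<bar> \<le> \<epsilon> * N"
  shows "ereal (inverse (w + \<epsilon>) * D') \<le> ereal N \<and> ereal N \<le> upper_bound w \<epsilon> D'"
proof
  have "D' \<le> (w + \<epsilon>) * N"
    using conc close by (simp add: abs_le_iff algebra_simps)
  then have "inverse (w + \<epsilon>) * D' \<le> inverse (w + \<epsilon>) * ((w + \<epsilon>) * N)"
    using w \<epsilon> by (intro mult_left_mono) auto
  moreover have "inverse (w + \<epsilon>) * ((w + \<epsilon>) * N) = N"
    using w \<epsilon> by simp
  ultimately show "ereal (inverse (w + \<epsilon>) * D') \<le> ereal N"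
    by simp
  have "N \<le> w * D"
    using conc w by (simp add: field_simps)
  also have "\<dots> \<le> w * (D' + \<epsilon> * N)"
    using close w by (intro mult_left_mono) (auto simp: abs_le_iff)
  finally have "(1 - w * \<epsilon>) * N \<le> w * D'"
    by (simp add: algebra_simps)
  then show "ereal N \<le> upper_bound w \<epsilon> D'"
    using \<epsilon> by (auto simp: upper_bound_def field_simps)
qed

section \<open>Probabilistic certification of the error estimator\<close>

theorem corollary3p2:
  fixes M :: "'w measure"
    and P S :: "(real ^ 'p) set"
    and A :: "real ^ 'p \<Rightarrow> real ^ 'n ^ 'n"
    and f u ut :: "real ^ 'p \<Rightarrow> real ^ 'n"
    and \<Sigma> :: "real ^ 'n ^ 'n"
    and K :: nat
    and Z :: "nat \<Rightarrow> 'w \<Rightarrow> real ^ 'n"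
    and Y Yt :: "nat \<Rightarrow> real ^ 'p \<Rightarrow> 'w \<Rightarrow> real ^ 'n"
    and V :: "'w \<Rightarrow> (real ^ 'n) set"
    and \<delta> w :: real
  defines "\<Delta> \<equiv> error_estimator K Yt (residual A f ut)"
    and "\<epsilon> \<equiv> dual_residual_sup P K A \<Sigma> Z Yt"
  assumes "prob_space M"
    and "\<And>\<mu>. \<mu> \<in> P \<Longrightarrow> invertible (A \<mu>)"
    and "\<And>\<mu>. \<mu> \<in> P \<Longrightarrow> A \<mu> *v u \<mu> = f \<mu>"
    and "transpose \<Sigma> = \<Sigma>"
    and "\<And>v. 0 \<le> v \<bullet> (\<Sigma> *v v)"
    and "invertible \<Sigma>"
    and "\<And>i. i \<in> {1..K} \<Longrightarrow> gaussian_vector M (Z i) 0 \<Sigma>"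
    and "prob_space.indep_vars M (\<lambda>_. borel) Z {1..K}"
    and "\<And>i \<mu> \<omega>. i \<in> {1..K} \<Longrightarrow> \<mu> \<in> P \<Longrightarrow> \<omega> \<in> space M \<Longrightarrow>
           transpose (A \<mu>) *v Y i \<mu> \<omega> = Z i \<omega>"
    and "\<And>\<omega>. \<omega> \<in> space M \<Longrightarrow> subspace (V \<omega>)"
    and "\<And>i \<mu> \<omega>. i \<in> {1..K} \<Longrightarrow> \<mu> \<in> P \<Longrightarrow> \<omega> \<in> space M \<Longrightarrow>
           \<exists>!y. galerkin_solution (transpose (A \<mu>)) (V \<omega>) (Z i \<omega>) y"
    and "\<And>i \<mu> \<omega>. i \<in> {1..K} \<Longrightarrow> \<mu> \<in> P \<Longrightarrow> \<omega> \<in> space M \<Longrightarrow>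
           galerkin_solution (transpose (A \<mu>)) (V \<omega>) (Z i \<omega>) (Yt i \<mu> \<omega>)"
    and "\<And>\<mu>. \<mu> \<in> P \<Longrightarrow> \<Delta> \<mu> \<in> borel_measurable M"
    and "\<epsilon> \<in> borel_measurable M"
    and "S \<subseteq> P" and "finite S" and "S \<noteq> {}"
    and "0 < \<delta>" and "\<delta> < 1"
    and "w > sqrt (exp 1)"
    and "real K \<ge> max ((ln (real (card S)) + ln (inverse \<delta>)) / ln (w / sqrt (exp 1))) 3"
    and "AE \<omega> in M. \<epsilon> \<omega> \<le> ereal (inverse w)"
  shows "measure M {\<omega> \<in> space M. \<forall>\<mu>\<in>S.
           ereal (inverse (w + real_of_ereal (\<epsilon> \<omega>)) * \<Delta> \<mu> \<omega>)
             \<le> ereal (weighted_norm \<Sigma> (u \<mu> - ut \<mu>)) \<and>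
           ereal (weighted_norm \<Sigma> (u \<mu> - ut \<mu>))
             \<le> upper_bound w (real_of_ereal (\<epsilon> \<omega>)) (\<Delta> \<mu> \<omega>)} \<ge> 1 - \<delta>"
proof -
  interpret prob_space M by fact
  note solves = assms(5) and sym = assms(6) and psd = assms(7) and inv\<Sigma> = assms(8)
    and gauss = assms(9) and indep = assms(10) and meas\<Delta> = assms(15) and meas\<epsilon> = assms(16)
    and SP = assms(17) and finS = assms(18) and neS = assms(19) and \<delta>0 = assms(20)
    and wlb = assms(22) and Klb = assms(23) and small = assms(24)
  have K3: "3 \<le> K" using Klb by simp
  have "(0::real) < sqrt (exp 1)" by simp
  with wlb have w0: "0 < w" by linarith
  define e where "e \<mu> = u \<mu> - ut \<mu>" for \<mu>
  define s where "s \<mu> = e \<mu> \<bullet> (\<Sigma> *v e \<mu>)" for \<mu>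
  define bad where "bad \<mu> = {\<omega> \<in> space M. \<not> (card {1..K} * (s \<mu> / w\<^sup>2) \<le> (\<Sum>i\<in>{1..K}. (e \<mu> \<bullet> Z i \<omega>)\<^sup>2) \<and>
      (\<Sum>i\<in>{1..K}. (e \<mu> \<bullet> Z i \<omega>)\<^sup>2) \<le> card {1..K} * (s \<mu> * w\<^sup>2))}" for \<mu>
  define good where "good = {\<omega> \<in> space M. \<forall>\<mu>\<in>S.
           ereal (inverse (w + real_of_ereal (\<epsilon> \<omega>)) * \<Delta> \<mu> \<omega>)
             \<le> ereal (weighted_norm \<Sigma> (u \<mu> - ut \<mu>)) \<and>
           ereal (weighted_norm \<Sigma> (u \<mu> - ut \<mu>))
             \<le> upper_bound w (real_of_ereal (\<epsilon> \<omega>)) (\<Delta> \<mu> \<omega>)}"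
  have [measurable]: "i \<in> {1..K} \<Longrightarrow> Z i \<in> borel_measurable M" for i
    using gauss[of i] by (simp add: gaussian_vector_def)
  have bad_sets [measurable]: "bad \<mu> \<in> events" for \<mu>
    unfolding bad_def by measurable

  \<comment> \<open>A zero error has zero variance, which the concentration bound excludes; but then no outcome
    is bad.\<close>
  have bad_prob: "prob (bad \<mu>) \<le> (sqrt (exp 1) / w) ^ K" for \<mu>
  proof (cases "e \<mu> = 0")
    case True
    then have "bad \<mu> = {}" by (simp add: bad_def s_def)
    then show ?thesis using w0 by simp
  next
    case False
    have "indep_vars (\<lambda>_. borel) (\<lambda>i \<omega>. e \<mu> \<bullet> Z i \<omega>) {1..K}"
      using indep by (rule indep_vars_compose2) auto
    moreover have "distr M borel (\<lambda>\<omega>. e \<mu> \<bullet> Z i \<omega>) = normal_law 0 (s \<mu>)" if "i \<in> {1..K}" for i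
      using gauss[OF that] by (simp add: gaussian_vector_def s_def)
    moreover have "0 < s \<mu>"
      unfolding s_def by (rule positive_definite[OF sym psd inv\<Sigma> False])
    ultimately have "prob (bad \<mu>) \<le> (sqrt (exp 1) / w) ^ card {1..K}"
      unfolding bad_def using wlb K3 by (intro normal_sum_squares_concentration) auto
    then show ?thesis by simp
  qed

  have "prob (\<Union>\<mu>\<in>S. bad \<mu>) \<le> (\<Sum>\<mu>\<in>S. prob (bad \<mu>))"
    using finS by (intro finite_measure_subadditive_finite) auto
  also have "\<dots> \<le> real (card S) * (sqrt (exp 1) / w) ^ K"
    using bad_prob by (intro sum_bounded_above) auto
  also have "\<dots> \<le> \<delta>"
    using wlb \<delta>0 finS neS Klb by (intro union_bound_budget) (auto simp: card_gt_0_iff)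
  finally have bad_total: "prob (\<Union>\<mu>\<in>S. bad \<mu>) \<le> \<delta>" .

  \<comment> \<open>Outside the bad events the two bounds hold for every single outcome with \<open>\<epsilon> \<le> 1 / w\<close>.\<close>
  have bounds: "ereal (inverse (w + real_of_ereal (\<epsilon> \<omega>)) * \<Delta> \<mu> \<omega>) \<le> ereal (weighted_norm \<Sigma> (e \<mu>)) \<and>
      ereal (weighted_norm \<Sigma> (e \<mu>)) \<le> upper_bound w (real_of_ereal (\<epsilon> \<omega>)) (\<Delta> \<mu> \<omega>)"
    if \<omega>: "\<omega> \<in> space M" and \<epsilon>w: "\<epsilon> \<omega> \<le> ereal (inverse w)" and \<mu>: "\<mu> \<in> S" and nb: "\<omega> \<notin> bad \<mu>" for \<omega> \<mu>
  proof -
    have \<mu>P: "\<mu> \<in> P" using \<mu> SP by blast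
    have norm_nonneg: "0 \<le> weighted_norm (matrix_inv \<Sigma>) v" for v
      by (rule dual_norm_nonneg[OF psd inv\<Sigma>])
    have term_le: "ereal (weighted_norm (matrix_inv \<Sigma>) (transpose (A \<mu>) *v Yt i \<mu> \<omega> - Z i \<omega>)) \<le> \<epsilon> \<omega>"
      if i: "i \<in> {1..K}" for i
    proof -
      have "weighted_norm (matrix_inv \<Sigma>) (transpose (A \<mu>) *v Yt i \<mu> \<omega> - Z i \<omega>)
          \<le> (MAX i\<in>{1..K}. weighted_norm (matrix_inv \<Sigma>) (transpose (A \<mu>) *v Yt i \<mu> \<omega> - Z i \<omega>))"
        using i by (intro Max_ge) auto
      also have "ereal \<dots> \<le> \<epsilon> \<omega>"
        unfolding \<epsilon>_def dual_residual_sup_def by (rule SUP_upper[OF \<mu>P])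
      finally show ?thesis by simp
    qed
    have "0 \<le> \<epsilon> \<omega>"
    proof -
      have "0 \<le> ereal (weighted_norm (matrix_inv \<Sigma>) (transpose (A \<mu>) *v Yt 1 \<mu> \<omega> - Z 1 \<omega>))"
        using norm_nonneg by simp
      also have "\<dots> \<le> \<epsilon> \<omega>" using K3 by (intro term_le) simp
      finally show ?thesis .
    qed
    \<comment> \<open>Being between \<open>0\<close> and \<open>1 / w\<close>, the extended real supremum is finite here.\<close>
    then obtain \<eta> where \<eta>: "\<epsilon> \<omega> = ereal \<eta>" "0 \<le> \<eta>" "\<eta> \<le> inverse w"
      using \<epsilon>w by (cases "\<epsilon> \<omega>") auto
    have w\<eta>: "w * \<eta> \<le> 1"
      using \<eta>(3) w0 by (simp add: field_simps)
    define N where "N = weighted_norm \<Sigma> (e \<mu>)"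
    have sN: "s \<mu> = N\<^sup>2" and N0: "0 \<le> N"
      using psd[of "e \<mu>"] by (simp_all add: N_def s_def weighted_norm_def)
    define D where "D = L2_set (\<lambda>i. e \<mu> \<bullet> Z i \<omega>) {1..K} / sqrt K"
    have D2: "real K * D\<^sup>2 = (\<Sum>i\<in>{1..K}. (e \<mu> \<bullet> Z i \<omega>)\<^sup>2)"
      using K3 by (simp add: D_def L2_set_def power_divide sum_nonneg)
    have D0: "0 \<le> D" by (simp add: D_def)
    have Kpos: "0 < real K" using K3 by simp
    have "real K * (s \<mu> / w\<^sup>2) \<le> real K * D\<^sup>2" and "real K * D\<^sup>2 \<le> real K * (s \<mu> * w\<^sup>2)"
      using nb \<omega> unfolding D2 by (simp_all add: bad_def)
    then have "s \<mu> / w\<^sup>2 \<le> D\<^sup>2" and "D\<^sup>2 \<le> s \<mu> * w\<^sup>2"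
      by (simp_all only: mult_le_cancel_left_pos[OF Kpos])
    then have "(N / w)\<^sup>2 \<le> D\<^sup>2" and "D\<^sup>2 \<le> (w * N)\<^sup>2"
      by (simp_all only: sN power_divide power_mult_distrib mult.commute)
    then have conc: "N / w \<le> D" "D \<le> w * N"
      using D0 N0 w0 by (auto elim: power2_le_imp_le)
    have \<Delta>: "\<Delta> \<mu> \<omega> = L2_set (\<lambda>i. Yt i \<mu> \<omega> \<bullet> residual A f ut \<mu>) {1..K} / sqrt K"
      by (simp add: \<Delta>_def error_estimator_def L2_set_def real_sqrt_divide)
    have res: "residual A f ut \<mu> = A \<mu> *v e \<mu>"
      using solves[OF \<mu>P] by (simp add: residual_def e_def matrix_vector_mult_diff_distrib)
    have "\<bar>Yt i \<mu> \<omega> \<bullet> residual A f ut \<mu> - e \<mu> \<bullet> Z i \<omega>\<bar> \<le> \<eta> * N" if i: "i \<in> {1..K}" for i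
    proof -
      have "Yt i \<mu> \<omega> \<bullet> residual A f ut \<mu> - e \<mu> \<bullet> Z i \<omega>
          = (transpose (A \<mu>) *v Yt i \<mu> \<omega> - Z i \<omega>) \<bullet> e \<mu>"
        unfolding res transpose_matrix_vector inner_diff_left dot_lmul_matrix
        by (simp add: inner_commute)
      also have "\<bar>\<dots>\<bar> \<le> weighted_norm (matrix_inv \<Sigma>) (transpose (A \<mu>) *v Yt i \<mu> \<omega> - Z i \<omega>) * N"
        unfolding N_def by (rule abs_inner_le_weighted_norm[OF sym psd inv\<Sigma>])
      also have "\<dots> \<le> \<eta> * N"
        using term_le[OF i] \<eta>(1) N0 by (intro mult_right_mono) auto
      finally show ?thesis .
    qed
    then have "\<bar>L2_set (\<lambda>i. Yt i \<mu> \<omega> \<bullet> residual A f ut \<mu>) {1..K} - L2_set (\<lambda>i. e \<mu> \<bullet> Z i \<omega>) {1..K}\<bar>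
        \<le> sqrt K * (\<eta> * N)"
      using L2_set_uniformly_close[of "{1..K}" "\<lambda>i. Yt i \<mu> \<omega> \<bullet> residual A f ut \<mu>" "\<lambda>i. e \<mu> \<bullet> Z i \<omega>"
          "\<eta> * N"] by simp
    then have "\<bar>\<Delta> \<mu> \<omega> - D\<bar> \<le> \<eta> * N"
      unfolding \<Delta> D_def diff_divide_distrib[symmetric] abs_divide using K3
      by (simp add: pos_divide_le_eq mult.commute)
    then show ?thesis
      using effectivity_bounds[OF w0 \<eta>(2) w\<eta> conc] by (simp add: \<eta>(1) N_def)
  qed

  \<comment> \<open>Without measurability, \<open>measure\<close> of the event would be \<open>0\<close> by convention.\<close>
  have good_sets: "good \<in> events"
  proof -
    have [measurable]: "\<epsilon> \<in> borel_measurable M" by (rule meas\<epsilon>)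
    have [measurable]: "\<mu> \<in> S \<Longrightarrow> \<Delta> \<mu> \<in> borel_measurable M" for \<mu>
      using meas\<Delta> SP by blast
    have [measurable]: "finite S" "countable S" using finS by (auto intro: countable_finite)
    show ?thesis
      unfolding good_def upper_bound_def using finS by measurable
  qed
  have "1 - \<delta> \<le> 1 - prob (\<Union>\<mu>\<in>S. bad \<mu>)"
    using bad_total by simp
  also have "\<dots> = prob (space M - (\<Union>\<mu>\<in>S. bad \<mu>))"
    using finS by (intro prob_compl[symmetric]) auto
  also have "\<dots> \<le> prob good"
  proof (rule finite_measure_mono_AE[OF _ good_sets])
    show "AE \<omega> in M. \<omega> \<in> space M - (\<Union>\<mu>\<in>S. bad \<mu>) \<longrightarrow> \<omega> \<in> good"
      using small
    proof (rule AE_mp, intro AE_I2 impI)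
      fix \<omega> assume "\<omega> \<in> space M" "\<epsilon> \<omega> \<le> ereal (inverse w)" "\<omega> \<in> space M - (\<Union>\<mu>\<in>S. bad \<mu>)"
      then show "\<omega> \<in> good"
        using bounds[unfolded e_def] by (auto simp: good_def)
    qed
  qed
  finally show ?thesis
    unfolding good_def .
qed

end
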